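(* Let $H$ be a digraph (possibly with loops) and $D$ an $H$-colored digraph such that for every vertex $x\in V(D)$ there exists an $xw$-$H$-walk for some vertex $w$ that is obstruction-free in $D$. Then $D$ has a kernel by $H$-walks.
   Context: An $H$-colored digraph is a finite digraph $D$ without loops with a coloring $\rho:A(D)\to V(H)$. A vertex $x$ is obstruction-free in $D$ if $(\rho(a),\rho(b))\in A(H)$ for every arc $a$ entering $x$ and every arc $b$ leaving $x$. An $H$-walk is a walk $(x_0,\ldots,x_n)$ such that $(\rho(x_{i-1},x_i),\rho(x_i,x_{i+1}))\in A(H)$ for every $i\in\{1,\ldots,n-1\}$. A kernel by $H$-walks is a set $S\subseteq V(D)$ such that there is no $H$-walk between two different vertices of $S$, and every vertex of $V(D)\setminus S$ has an $H$-walk to some vertex of $S$. *)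

theory Defs
  imports "Graph_Theory.Pair_Digraph" "Graph_Theory.Vertex_Walk"
begin

text \<open>
  Neither looplessness nor finiteness is required of \<open>H\<close>. The values of the colouring \<open>\<rho>\<close> on
  pairs that are not arcs of \<open>D\<close> are irrelevant.
\<close>

locale H_colored_digraph =
  H: pair_wf_digraph H + D: pair_digraph D
  for H :: "'c pair_pre_digraph" and D :: "'v pair_pre_digraph" +
  fixes \<rho> :: "'v \<times> 'v \<Rightarrow> 'c"
  assumes coloring: "\<And>a. a \<in> parcs D \<Longrightarrow> \<rho> a \<in> pverts H"

definition obstruction_free ::
  "'c pair_pre_digraph \<Rightarrow> 'v pair_pre_digraph \<Rightarrow> ('v \<times> 'v \<Rightarrow> 'c) \<Rightarrow> 'v \<Rightarrow> bool" where
  "obstruction_free H D \<rho> x \<longleftrightarrow> x \<in> pverts D \<and>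
     (\<forall>a \<in> in_arcs (with_proj D) x. \<forall>b \<in> out_arcs (with_proj D) x. (\<rho> a, \<rho> b) \<in> parcs H)"

text \<open>
  A walk \<open>(x\<^sub>0, \<dots>, x\<^sub>n)\<close> is the list \<open>p\<close> with \<open>p ! i = x\<^sub>i\<close> and \<open>n = length p - 1\<close>. The case \<open>n = 0\<close>
  is allowed, so the one-vertex list \<open>[x]\<close> is an \<open>H\<close>-walk from \<open>x\<close> to \<open>x\<close>.
\<close>

definition H_walk ::
  "'c pair_pre_digraph \<Rightarrow> 'v pair_pre_digraph \<Rightarrow> ('v \<times> 'v \<Rightarrow> 'c) \<Rightarrow> 'v vwalk \<Rightarrow> bool" where
  "H_walk H D \<rho> p \<longleftrightarrow> vwalk p (with_proj D) \<and>
     (\<forall>i \<in> {1..<length p - 1}. (\<rho> (p ! (i - 1), p ! i), \<rho> (p ! i, p ! (i + 1))) \<in> parcs H)"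

definition H_walk_from_to ::
  "'c pair_pre_digraph \<Rightarrow> 'v pair_pre_digraph \<Rightarrow> ('v \<times> 'v \<Rightarrow> 'c) \<Rightarrow> 'v \<Rightarrow> 'v vwalk \<Rightarrow> 'v \<Rightarrow> bool" where
  "H_walk_from_to H D \<rho> u p v \<longleftrightarrow> H_walk H D \<rho> p \<and> hd p = u \<and> last p = v"

definition kernel_by_H_walks ::
  "'c pair_pre_digraph \<Rightarrow> 'v pair_pre_digraph \<Rightarrow> ('v \<times> 'v \<Rightarrow> 'c) \<Rightarrow> 'v set \<Rightarrow> bool" where
  "kernel_by_H_walks H D \<rho> S \<longleftrightarrow> S \<subseteq> pverts D \<and>
     (\<forall>u \<in> S. \<forall>v \<in> S. u \<noteq> v \<longrightarrow> \<not> (\<exists>p. H_walk_from_to H D \<rho> u p v)) \<and>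
     (\<forall>x \<in> pverts D - S. \<exists>s \<in> S. \<exists>p. H_walk_from_to H D \<rho> x p s)"

end

theory Submission
  imports Defs
begin

text \<open>
  Two \<open>H\<close>-walks that meet at an obstruction-free vertex concatenate to an \<open>H\<close>-walk. Hence
  reachability by \<open>H\<close>-walks is a preorder on the obstruction-free vertices, and since every vertex
  reaches one of them, a kernel of this finite preorder is a kernel of \<open>D\<close>.
\<close>

text \<open>Such an \<open>S\<close> consists of one element from each terminal class of mutual
  \<open>R\<close>-reachability. The induction builds it point by point instead of forming the
  classes: a new point that already reaches \<open>S\<close> changes nothing.\<close>

lemma finite_preorder_has_kernel:
  assumes "finite W" "reflp_on W R" "transp_on W R"
  shows "\<exists>S \<subseteq> W. (\<forall>u \<in> S. \<forall>v \<in> S. u \<noteq> v \<longrightarrow> \<not> R u v) \<and> (\<forall>w \<in> W. \<exists>s \<in> S. R w s)"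
  using assms
proof (induction W rule: finite_induct)
  case empty
  then show ?case by simp
next
  case (insert x W)
  obtain S where S: "S \<subseteq> W" "\<forall>u \<in> S. \<forall>v \<in> S. u \<noteq> v \<longrightarrow> \<not> R u v"
    "\<forall>w \<in> W. \<exists>s \<in> S. R w s"
    using insert.IH[OF reflp_on_subset transp_on_subset, OF insert.prems(1) _ insert.prems(2)]
    by blast
  show ?case
  proof (cases "\<exists>s \<in> S. R x s")
    case True
    with S show ?thesis by (intro exI[of _ S] conjI) blast+
  next
    case False
    \<comment> \<open>Here \<open>x\<close> reaches nothing in \<open>S\<close>, so adding it can
      only spoil independence through those \<open>s\<close> that reach \<open>x\<close>. These are
      dropped, and \<open>x\<close> takes over whatever they absorbed, by transitivity.\<close>
    let ?S = "insert x {s \<in> S. \<not> R s x}"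
    have "\<exists>s \<in> ?S. R w s" if "w \<in> insert x W" for w
    proof (cases "w = x")
      case True
      then show ?thesis using insert.prems(1) by (auto dest: reflp_onD)
    next
      case False
      with that S obtain s where s: "s \<in> S" "R w s" by auto
      show ?thesis
      proof (cases "R s x")
        case True
        with s S(1) that have "R w x" by (intro transp_onD[OF insert.prems(2), of w s x]) auto
        then show ?thesis by simp
      next
        case False
        with s show ?thesis by blast
      qed
    qed
    with S False show ?thesis by (intro exI[of _ ?S] conjI) blast+
  qed
qed

lemma vwalk_nth_arc:
  assumes "vwalk p G" "i + 1 < length p"
  shows "(p ! i, p ! (i + 1)) \<in> arcs_ends G"
  using assms
proof (induction arbitrary: i)
  case (Cons u v p)
  then show ?case by (cases i; cases p) auto
qed simp

text \<open>The colour condition concerns only consecutive arcs. The one pair of arcs not inherited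
  from \<open>p\<close> or \<open>q\<close> is the pair meeting at \<open>w\<close>, and
  obstruction-freeness admits every colour pair there.\<close>

lemma H_walk_join_at_obstruction_free:
  assumes w: "obstruction_free H D \<rho> w"
    and p: "H_walk_from_to H D \<rho> u p w" and q: "H_walk_from_to H D \<rho> w q v"
  shows "H_walk_from_to H D \<rho> u (p \<oplus> q) v" (is "H_walk_from_to _ _ _ _ ?r _")
proof -
  have p': "vwalk p (with_proj D)" "hd p = u" "last p = w" "p \<noteq> []"
    and pH: "\<And>i. i \<in> {1..<length p - 1} \<Longrightarrow> (\<rho> (p ! (i - 1), p ! i), \<rho> (p ! i, p ! (i + 1))) \<in> parcs H"
    using p unfolding H_walk_from_to_def H_walk_def by auto
  have q': "vwalk q (with_proj D)" "hd q = w" "last q = v" "q \<noteq> []"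
    and qH: "\<And>i. i \<in> {1..<length q - 1} \<Longrightarrow> (\<rho> (q ! (i - 1), q ! i), \<rho> (q ! i, q ! (i + 1))) \<in> parcs H"
    using q unfolding H_walk_from_to_def H_walk_def by auto
  \<comment> \<open>The index of the shared vertex \<open>w\<close> in \<open>?r\<close>. Both
    \<open>nth_p\<close> (up to \<open>m\<close>) and \<open>nth_q\<close> (from \<open>m\<close>
    on) cover it; they rest on the two forms \<open>p @ tl q\<close> and
    \<open>butlast p @ q\<close> of the join.\<close>
  define m where "m = length p - 1"
  have join: "joinable p q" using p' q' by (simp add: joinable_def)
  have walk: "vwalk ?r (with_proj D)"
    using p'(1) q'(1) join by (rule vwalk_joinI_vwalk)
  have nth_p: "?r ! j = p ! j" if "j \<le> m" for j
  proof -
    have "j < length p" using that p'(4) unfolding m_def by (cases p) auto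
    then show ?thesis by (simp add: vwalk_join_def nth_append)
  qed
  have nth_q: "?r ! (m + j) = q ! j" for j
    unfolding vwalk_join_def2[OF join] m_def length_butlast[symmetric] by (rule nth_append_length_plus)
  have "p ! m = w" using p' by (simp add: m_def last_conv_nth)
  have len: "length ?r - 1 = m + (length q - 1)"
    using q'(4) unfolding vwalk_join_def2[OF join] m_def by (cases q) auto
  have "(\<rho> (?r ! (i - 1), ?r ! i), \<rho> (?r ! i, ?r ! (i + 1))) \<in> parcs H"
    if i: "i \<in> {1..<length ?r - 1}" for i
  proof -
    consider "i < m" | "i = m" | "m < i" by linarith
    then show ?thesis
    proof cases
      case 1
      then show ?thesis using pH[of i] i by (simp add: nth_p m_def)
    next
      case 2
      \<comment> \<open>The bounds on \<open>i\<close> ensure that \<open>?r\<close> has an arc on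
        each side of index \<open>m\<close>, so neither \<open>p\<close> nor \<open>q\<close> is a
        one-vertex walk here.\<close>
      have "(?r ! (i - 1), ?r ! i) \<in> in_arcs (with_proj D) w"
        using vwalk_nth_arc[OF walk, of "i - 1"] i \<open>p ! m = w\<close> by (auto simp: 2 nth_p)
      moreover have "(?r ! i, ?r ! (i + 1)) \<in> out_arcs (with_proj D) w"
        using vwalk_nth_arc[OF walk, of i] i \<open>p ! m = w\<close> by (auto simp: 2 nth_p)
      ultimately show ?thesis using w unfolding obstruction_free_def by blast
    next
      case 3
      define j where "j = i - m"
      have j: "i = m + j" "j \<in> {1..<length q - 1}"
        using 3 i len by (auto simp: j_def)
      \<comment> \<open>Since \<open>j\<close> is at least 1, the natural-number subtraction
        \<open>j - 1\<close> does not truncate.\<close>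
      then have "i - 1 = m + (j - 1)" "i + 1 = m + (j + 1)" by auto
      moreover have "?r ! (m + (j - 1)) = q ! (j - 1)" "?r ! (m + j) = q ! j"
        "?r ! (m + (j + 1)) = q ! (j + 1)"
        by (rule nth_q)+
      ultimately show ?thesis using qH[OF j(2)] j(1) by metis
    qed
  qed
  moreover have "hd ?r = u" using p'(2) join by (simp add: vwalk_join_hd)
  moreover have "last ?r = v" using q'(3) join by (simp add: vwalk_join_last)
  ultimately show ?thesis using walk unfolding H_walk_from_to_def H_walk_def by blast
qed

theorem theorem4:
  fixes H :: "'c pair_pre_digraph" and D :: "'v pair_pre_digraph" and \<rho> :: "'v \<times> 'v \<Rightarrow> 'c"
  assumes "H_colored_digraph H D \<rho>"
    and "\<And>x. x \<in> pverts D \<Longrightarrow> \<exists>w p. obstruction_free H D \<rho> w \<and> H_walk_from_to H D \<rho> x p w"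
  shows "\<exists>S. kernel_by_H_walks H D \<rho> S"
proof -
  interpret H_colored_digraph H D \<rho> by fact
  define W where "W = {w. obstruction_free H D \<rho> w}"
  define R where "R u v \<longleftrightarrow> (\<exists>p. H_walk_from_to H D \<rho> u p v)" for u v
  have "W \<subseteq> pverts D" by (auto simp: W_def obstruction_free_def)
  \<comment> \<open>Only the middle vertex must lie in \<open>W\<close>. With \<open>u\<close>
    arbitrary, this later extends a walk from any vertex of \<open>D\<close> into \<open>W\<close>
    to a walk ending in \<open>S\<close>.\<close>
  have trans: "R u w" if "v \<in> W" "R u v" "R v w" for u v w
    using that by (auto simp: R_def W_def intro: H_walk_join_at_obstruction_free)
  have "transp_on W R"
    by (rule transp_onI) (rule trans)
  have "H_walk_from_to H D \<rho> w [w] w" if "w \<in> W" for w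
    using that \<open>W \<subseteq> pverts D\<close> by (auto simp: H_walk_from_to_def H_walk_def)
  then have "reflp_on W R"
    unfolding R_def by (blast intro: reflp_onI)
  have "finite W"
    using \<open>W \<subseteq> pverts D\<close> D.pair_finite_verts by (rule finite_subset)
  then obtain S where S: "S \<subseteq> W" "\<forall>u \<in> S. \<forall>v \<in> S. u \<noteq> v \<longrightarrow> \<not> R u v"
    "\<forall>w \<in> W. \<exists>s \<in> S. R w s"
    using finite_preorder_has_kernel \<open>reflp_on W R\<close> \<open>transp_on W R\<close> by metis
  have "\<exists>s \<in> S. R x s" if x: "x \<in> pverts D" for x
  proof -
    obtain w where "w \<in> W" "R x w" using assms(2)[OF x] by (auto simp: W_def R_def)
    moreover obtain s where "s \<in> S" "R w s" using S(3) \<open>w \<in> W\<close> by blast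
    ultimately show ?thesis using trans[of w x s] by blast
  qed
  then have "\<forall>x \<in> pverts D - S. \<exists>s \<in> S. R x s" by simp
  moreover have "S \<subseteq> pverts D" using S(1) \<open>W \<subseteq> pverts D\<close> by (rule subset_trans)
  ultimately have "kernel_by_H_walks H D \<rho> S"
    using S(2) by (simp add: kernel_by_H_walks_def R_def)
  then show ?thesis ..
qed

end
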